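(* For all $N\in[1,\infty]$ and all $f,g,h\in\mathcal A$, pointwise on $X$, $$\Gamma_2(f)\ \ge\ R_N(f)+\frac1N(Lf)^2+2\,\frac{\big[H_f(g,h)-\frac1N\Gamma(g,h)\,Lf\big]^2}{\frac{N-2}N\Gamma(g,h)^2+\Gamma(g)\,\Gamma(h)}.$$
   Context: Let $X$ be a set, $\mathcal A$ an algebra of real-valued functions on $X$ and $L:\mathcal A\to\mathcal A$ a linear operator. Put $\Gamma(f,g)=\frac12[L(fg)-fLg-gLf]$ and $\Gamma(f)=\Gamma(f,f)$. $L$ is assumed to be a diffusion operator: $\Gamma(f)\ge0$ for all $f\in\mathcal A$, and for all $r$, all $f_1,\dots,f_r\in\mathcal A$ and every $C^\infty$ function $\psi:\mathbb R^r\to\mathbb R$ with $\psi(0)=0$ one has $\psi(f_1,\dots,f_r)\in\mathcal A$ and $L\psi(f_1,\dots,f_r)=\sum_i\psi_i(f_1,\dots,f_r)\,Lf_i+\sum_{i,j}\psi_{ij}(f_1,\dots,f_r)\,\Gamma(f_i,f_j)$, where $\psi_i,\psi_{ij}$ are partial derivatives. $L,\Gamma$ are extended to the algebra generated by $\mathcal A$ and the constants by $L1=0$, $\Gamma(1,f)=0$. Define $\Gamma_2(f,g)=\frac12[L\Gamma(f,g)-\Gamma(f,Lg)-\Gamma(g,Lf)]$, $\Gamma_2(f)=\Gamma_2(f,f)$, the Hessian $H_f(g,h)=\frac12[\Gamma(g,\Gamma(f,h))+\Gamma(h,\Gamma(f,g))-\Gamma(f,\Gamma(g,h))]$, and for $N\in[1,\infty]$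 the $N$-Ricci tensor $R_N(f)(x)=\inf\{\Gamma_2(\tilde f)(x)-\frac1N(L\tilde f)^2(x):\tilde f\in\mathcal A,\ \Gamma(\tilde f-f)(x)=0\}\in[-\infty,\infty)$. Conventions: for $N=\infty$, $\frac1N=0$ and $\frac{N-2}N=1$. The denominator is always $\ge0$; at points where it vanishes the quotient is read as $0$ if the numerator vanishes and $+\infty$ otherwise, and the inequality is read as $R_N(f)\le\Gamma_2(f)-(\dots)$ in $[-\infty,\infty)$. *)

theory Defs
  imports "HOL-Analysis.Analysis"
begin

(* A function on R^r is encoded as a function of real sequences that only depends on the
   coordinates 0, ..., r-1; this allows r to be quantified inside a formula.  For such
   functions, continuity in the product topology on nat => real is continuity on R^r. *)

definition depends_on_first :: "nat \<Rightarrow> ((nat \<Rightarrow> real) \<Rightarrow> real) \<Rightarrow> bool" where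
  "depends_on_first r \<psi> \<longleftrightarrow> (\<forall>x y. (\<forall>i<r. x i = y i) \<longrightarrow> \<psi> x = \<psi> y)"

definition partial_deriv :: "nat \<Rightarrow> ((nat \<Rightarrow> real) \<Rightarrow> real) \<Rightarrow> (nat \<Rightarrow> real) \<Rightarrow> real" where
  "partial_deriv i \<psi> x = deriv (\<lambda>t. \<psi> (x(i := t))) (x i)"

(* C^infinity: all iterated partial derivatives exist everywhere and are continuous. *)
definition smooth_fun :: "nat \<Rightarrow> ((nat \<Rightarrow> real) \<Rightarrow> real) \<Rightarrow> bool" where
  "smooth_fun r \<psi> \<longleftrightarrow> depends_on_first r \<psi> \<and>
     (\<forall>is. set is \<subseteq> {..<r} \<longrightarrow>
        continuous_on UNIV (foldr partial_deriv is \<psi>) \<and>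
        (\<forall>i<r. \<forall>x. (\<lambda>t. foldr partial_deriv is \<psi> (x(i := t))) field_differentiable at (x i)))"

definition Gam ::
  "(('x \<Rightarrow> real) \<Rightarrow> ('x \<Rightarrow> real)) \<Rightarrow> ('x \<Rightarrow> real) \<Rightarrow> ('x \<Rightarrow> real) \<Rightarrow> 'x \<Rightarrow> real" where
  "Gam L f g = (\<lambda>x. (L (\<lambda>y. f y * g y) x - f x * L g x - g x * L f x) / 2)"

definition Gam2 ::
  "(('x \<Rightarrow> real) \<Rightarrow> ('x \<Rightarrow> real)) \<Rightarrow> ('x \<Rightarrow> real) \<Rightarrow> ('x \<Rightarrow> real) \<Rightarrow> 'x \<Rightarrow> real" where
  "Gam2 L f g = (\<lambda>x. (L (Gam L f g) x - Gam L f (L g) x - Gam L g (L f) x) / 2)"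

definition Hess ::
  "(('x \<Rightarrow> real) \<Rightarrow> ('x \<Rightarrow> real)) \<Rightarrow> ('x \<Rightarrow> real) \<Rightarrow> ('x \<Rightarrow> real) \<Rightarrow> ('x \<Rightarrow> real) \<Rightarrow> 'x \<Rightarrow> real" where
  "Hess L f g h = (\<lambda>x. (Gam L g (Gam L f h) x + Gam L h (Gam L f g) x - Gam L f (Gam L g h) x) / 2)"

(* L is only meaningful on A; its values outside A are unconstrained. *)
locale diffusion_operator =
  fixes A :: "('x \<Rightarrow> real) set" and L :: "('x \<Rightarrow> real) \<Rightarrow> ('x \<Rightarrow> real)"
  assumes zero_closed: "(\<lambda>x. 0) \<in> A"
    and add_closed: "f \<in> A \<Longrightarrow> g \<in> A \<Longrightarrow> (\<lambda>x. f x + g x) \<in> A"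
    and scale_closed: "f \<in> A \<Longrightarrow> (\<lambda>x. c * f x) \<in> A"
    and mult_closed: "f \<in> A \<Longrightarrow> g \<in> A \<Longrightarrow> (\<lambda>x. f x * g x) \<in> A"
    and L_closed: "f \<in> A \<Longrightarrow> L f \<in> A"
    and L_add: "f \<in> A \<Longrightarrow> g \<in> A \<Longrightarrow> L (\<lambda>x. f x + g x) = (\<lambda>x. L f x + L g x)"
    and L_scale: "f \<in> A \<Longrightarrow> L (\<lambda>x. c * f x) = (\<lambda>x. c * L f x)"
    and Gam_nonneg: "f \<in> A \<Longrightarrow> Gam L f f x \<ge> 0"
    and comp_closed:
      "smooth_fun r \<psi> \<Longrightarrow> \<psi> (\<lambda>_. 0) = 0 \<Longrightarrow> (\<And>i. i < r \<Longrightarrow> F i \<in> A) \<Longrightarrow>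
        (\<lambda>x. \<psi> (\<lambda>k. F k x)) \<in> A"
    and L_comp:
      "smooth_fun r \<psi> \<Longrightarrow> \<psi> (\<lambda>_. 0) = 0 \<Longrightarrow> (\<And>i. i < r \<Longrightarrow> F i \<in> A) \<Longrightarrow>
        L (\<lambda>x. \<psi> (\<lambda>k. F k x)) x =
          (\<Sum>i<r. partial_deriv i \<psi> (\<lambda>k. F k x) * L (F i) x) +
          (\<Sum>i<r. \<Sum>j<r. partial_deriv j (partial_deriv i \<psi>) (\<lambda>k. F k x) * Gam L (F i) (F j) x)"

(* The numbers 1/N and (N-2)/N for N in [1, infinity]; ereal arithmetic would give
   (infinity - 2)/infinity = 0. *)

definition inv_dim :: "ereal \<Rightarrow> real" where
  "inv_dim N = (if N = \<infinity> then 0 else 1 / real_of_ereal N)"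

definition dim_ratio :: "ereal \<Rightarrow> real" where
  "dim_ratio N = (if N = \<infinity> then 1 else (real_of_ereal N - 2) / real_of_ereal N)"

definition Ricci ::
  "('x \<Rightarrow> real) set \<Rightarrow> (('x \<Rightarrow> real) \<Rightarrow> ('x \<Rightarrow> real)) \<Rightarrow> ereal \<Rightarrow> ('x \<Rightarrow> real) \<Rightarrow> 'x \<Rightarrow> ereal" where
  "Ricci A L N f x =
     (INF f' \<in> {f' \<in> A. Gam L (\<lambda>y. f' y - f y) (\<lambda>y. f' y - f y) x = 0}.
        ereal (Gam2 L f' f' x - inv_dim N * (L f' x)\<^sup>2))"

definition ext_quot :: "real \<Rightarrow> real \<Rightarrow> ereal" where
  "ext_quot a b = (if b = 0 then (if a = 0 then 0 else \<infinity>) else ereal (a / b))"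

end

theory Submission
  imports Defs
begin

text \<open>
  The Ricci tensor is an infimum over all functions with the same gradient as \<open>f\<close> at the
  point \<open>x\<close>, so every such function bounds it from above. The ones used here perturb only the
  second order behaviour of \<open>f\<close> at \<open>x\<close>: they are \<open>f + t k\<close> for real \<open>t\<close>, where
  \<open>k = g h - g(x) h - h(x) g\<close>. Up to the additive constant \<open>g(x) h(x)\<close>, \<open>k\<close> is
  the product of the two functions \<open>g - g(x)\<close> and \<open>h - h(x)\<close> that vanish at \<open>x\<close>. Writing \<open>\<Gamma>\<close>, \<open>\<Gamma>\<^sub>2\<close> and
  \<open>H\<close> for the carre du champ, its iterate and the Hessian, one has at the point \<open>x\<close>

  \<^item> \<open>\<Gamma>(k, w) = 0\<close> for all \<open>w\<close>, so that \<open>f + t k\<close> is admissible (\<open>Gam_centred_product_at\<close>),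
  \<^item> \<open>L k = 2 \<Gamma>(g, h)\<close> (\<open>L_centred_product_at\<close>),
  \<^item> \<open>\<Gamma>\<^sub>2(f, k) = 2 H\<^sub>f(g, h)\<close> (\<open>Gam2_centred_product_at\<close>),
  \<^item> \<open>\<Gamma>\<^sub>2(k, k) = 2 (\<Gamma>(g, g) \<Gamma>(h, h) + \<Gamma>(g, h)\<^sup>2)\<close> (\<open>Gam2_centred_product_self_at\<close>).

  Hence for every \<open>t\<close> the Ricci tensor is at most
  \<open>\<Gamma>\<^sub>2(f) - (L f)\<^sup>2 / N + 4 t b + 2 t\<^sup>2 c\<close>, where
  \<open>b = H\<^sub>f(g, h) - \<Gamma>(g, h) L f / N\<close> is the bracket in the numerator of the claim and
  \<open>c = \<Gamma>(g, g) \<Gamma>(h, h) + (1 - 2 / N) \<Gamma>(g, h)\<^sup>2\<close> is its denominator. The choice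
  \<open>t = - b / c\<close> gives the term \<open>- 2 b\<^sup>2 / c\<close>; if \<open>c = 0 \<noteq> b\<close>, the bound is a nonconstant
  affine function of \<open>t\<close>, and the Ricci tensor is \<open>-\<infinity>\<close>.

  The values at \<open>x\<close> follow from the Leibniz rule \<open>Gam_mult\<close> for \<open>\<Gamma>\<close> and from the product rule
  \<open>Gam2_mult_right\<close> for \<open>\<Gamma>\<^sub>2\<close>, in which the Hessian appears as the defect from a derivation.
  The Leibniz rule itself is the chain rule for \<open>L\<close>, applied to a product of three functions.
\<close>

section \<open>Smoothness of polynomials\<close>

text \<open>Applying the chain rule to a monomial requires continuity of all its iterated partial
  derivatives. Membership in a class that consists of continuous functions and is stable under
  partial differentiation gives all of them at once.\<close>

inductive polynomial_fun :: "nat \<Rightarrow> ((nat \<Rightarrow> real) \<Rightarrow> real) \<Rightarrow> bool" for r where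
  const: "polynomial_fun r (\<lambda>x. c)"
| coord: "i < r \<Longrightarrow> polynomial_fun r (\<lambda>x. x i)"
| add: "polynomial_fun r p \<Longrightarrow> polynomial_fun r q \<Longrightarrow> polynomial_fun r (\<lambda>x. p x + q x)"
| mult: "polynomial_fun r p \<Longrightarrow> polynomial_fun r q \<Longrightarrow> polynomial_fun r (\<lambda>x. p x * q x)"

lemma polynomial_fun_depends:
  "polynomial_fun r p \<Longrightarrow> depends_on_first r p"
  unfolding depends_on_first_def
proof (induction rule: polynomial_fun.induct)
  case (add p q)
  then show ?case by metis
next
  case (mult p q)
  then show ?case by metis
qed auto

lemma polynomial_fun_continuous:
  "polynomial_fun r p \<Longrightarrow> continuous_on UNIV p"
  by (induction rule: polynomial_fun.induct)
     (auto intro!: continuous_intros continuous_on_product_coordinates)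

text \<open>Existence and value of the partial derivative are proved together: \<open>partial_deriv\<close> alone
  would not carry the differentiability that the sum and product rules in the induction need.\<close>

lemma polynomial_fun_partial:
  assumes "polynomial_fun r p"
  shows "\<exists>q. polynomial_fun r q \<and>
           (\<forall>x. ((\<lambda>t. p (x(i := t))) has_field_derivative q x) (at (x i)))"
  using assms
proof (induction rule: polynomial_fun.induct)
  case (const c)
  then show ?case
    by (intro exI[of _ "\<lambda>x. 0"]) (auto intro: polynomial_fun.const)
next
  case (coord j)
  then show ?case
    by (intro exI[of _ "\<lambda>x. if i = j then 1 else 0"])
       (auto intro: polynomial_fun.const)
next
  case (add p q)
  then obtain p' q' where "polynomial_fun r p'" "polynomial_fun r q'"
    and "\<And>x. ((\<lambda>t. p (x(i := t))) has_field_derivative p' x) (at (x i))"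
    and "\<And>x. ((\<lambda>t. q (x(i := t))) has_field_derivative q' x) (at (x i))"
    by blast
  then show ?case
    by (intro exI[of _ "\<lambda>x. p' x + q' x"] conjI allI polynomial_fun.add DERIV_add)
next
  case (mult p q)
  then obtain p' q' where "polynomial_fun r p'" "polynomial_fun r q'"
    and p': "\<And>x. ((\<lambda>t. p (x(i := t))) has_field_derivative p' x) (at (x i))"
    and q': "\<And>x. ((\<lambda>t. q (x(i := t))) has_field_derivative q' x) (at (x i))"
    by blast
  moreover have "((\<lambda>t. p (x(i := t)) * q (x(i := t))) has_field_derivative p' x * q x + q' x * p x) (at (x i))" for x
    using DERIV_mult[OF p'[of x] q'[of x]] by simp
  ultimately show ?case
    using mult.hyps
    by (intro exI[of _ "\<lambda>x. p' x * q x + q' x * p x"])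
       (simp add: polynomial_fun.add polynomial_fun.mult del: fun_upd_apply)
qed

lemma partial_deriv_eqI:
  assumes "\<And>x. ((\<lambda>t. p (x(i := t))) has_field_derivative q x) (at (x i))"
  shows "partial_deriv i p = q"
  by (rule ext) (simp add: partial_deriv_def DERIV_imp_deriv[OF assms])

lemma polynomial_fun_partial_deriv:
  assumes "polynomial_fun r p"
  shows "polynomial_fun r (partial_deriv i p)"
    and "(\<lambda>t. p (x(i := t))) field_differentiable at (x i)"
proof -
  obtain q where q: "polynomial_fun r q"
    "\<And>x. ((\<lambda>t. p (x(i := t))) has_field_derivative q x) (at (x i))"
    using polynomial_fun_partial[OF assms] by blast
  have "partial_deriv i p = q"
    by (rule partial_deriv_eqI) (rule q(2))
  with q show "polynomial_fun r (partial_deriv i p)" by simp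
  show "(\<lambda>t. p (x(i := t))) field_differentiable at (x i)"
    using q(2) field_differentiable_def by blast
qed

lemma polynomial_fun_smooth:
  assumes "polynomial_fun r p"
  shows "smooth_fun r p"
proof -
  have "polynomial_fun r (foldr partial_deriv js p)" for js
    by (induction js) (auto simp: assms polynomial_fun_partial_deriv(1))
  then show ?thesis
    unfolding smooth_fun_def
    using assms polynomial_fun_continuous polynomial_fun_depends polynomial_fun_partial_deriv(2)
    by blast
qed

lemma partial_deriv_coord_mult:
  assumes "i \<noteq> j"
  shows "partial_deriv i (\<lambda>x. x i * x j) = (\<lambda>x. x j)"
    and "partial_deriv i (\<lambda>x. x j * x i) = (\<lambda>x. x j)"
  using assms
  by (auto intro!: partial_deriv_eqI derivative_eq_intros)

lemma partial_deriv_coord_mult_other: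
  assumes "l \<noteq> i" "l \<noteq> j"
  shows "partial_deriv l (\<lambda>x. x i * x j) = (\<lambda>x. 0)"
  using assms by (auto intro!: partial_deriv_eqI)

lemma partial_deriv_triple:
  "partial_deriv 0 (\<lambda>x. x 0 * x (Suc 0) * x 2) = (\<lambda>x. x (Suc 0) * x 2)"
  "partial_deriv (Suc 0) (\<lambda>x. x 0 * x (Suc 0) * x 2) = (\<lambda>x. x 0 * x 2)"
  "partial_deriv 2 (\<lambda>x. x 0 * x (Suc 0) * x 2) = (\<lambda>x. x 0 * x (Suc 0))"
  by (auto intro!: partial_deriv_eqI derivative_eq_intros)

section \<open>The calculus of the carre du champ\<close>

context diffusion_operator
begin

lemma Gam_sym: "Gam L u v = Gam L v u"
  by (simp add: Gam_def mult.commute algebra_simps)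

text \<open>The chain rule for the monomial \<open>x\<^sub>0 x\<^sub>1 x\<^sub>2\<close>. Products of
  three functions arise when \<open>\<Gamma>(u v, w)\<close> is written out in terms of \<open>L\<close>.\<close>

lemma L_triple_product:
  assumes "u \<in> A" "v \<in> A" "w \<in> A"
  shows "L (\<lambda>y. u y * v y * w y) x =
    u x * v x * L w x + u x * w x * L v x + v x * w x * L u x
    + 2 * (u x * Gam L v w x + v x * Gam L u w x + w x * Gam L u v x)"
proof -
  define F where "F = (\<lambda>k::nat. if k = 0 then u else if k = Suc 0 then v else w)"
  define \<psi> where "\<psi> = (\<lambda>x::nat \<Rightarrow> real. x 0 * x (Suc 0) * x 2)"
  have "smooth_fun 3 \<psi>"
    unfolding \<psi>_def
    by (intro polynomial_fun_smooth polynomial_fun.mult polynomial_fun.coord) auto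
  moreover have "\<psi> (\<lambda>_. 0) = 0" by (simp add: \<psi>_def)
  moreover have "F i \<in> A" for i using assms by (simp add: F_def)
  ultimately have *: "L (\<lambda>y. \<psi> (\<lambda>k. F k y)) x =
          (\<Sum>i<3. partial_deriv i \<psi> (\<lambda>k. F k x) * L (F i) x) +
          (\<Sum>i<3. \<Sum>j<3. partial_deriv j (partial_deriv i \<psi>) (\<lambda>k. F k x) * Gam L (F i) (F j) x)"
    by (rule L_comp)
  have three: "{..<3::nat} = {0, Suc 0, 2}" by auto
  have F: "F 0 = u" "F (Suc 0) = v" "F 2 = w" by (simp_all add: F_def)
  have "(\<lambda>y. \<psi> (\<lambda>k. F k y)) = (\<lambda>y. u y * v y * w y)"
    by (simp add: \<psi>_def F_def)
  with * show ?thesis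
    unfolding three \<psi>_def
    by (simp add: partial_deriv_triple partial_deriv_coord_mult
        partial_deriv_coord_mult_other F Gam_sym[of w u] Gam_sym[of w v] Gam_sym[of v u])
qed

lemma Gam_closed:
  assumes "u \<in> A" "v \<in> A"
  shows "Gam L u v \<in> A"
proof -
  have "(\<lambda>x. (1/2) * (L (\<lambda>y. u y * v y) x + ((-1) * (u x * L v x) + (-1) * (v x * L u x)))) \<in> A"
    using assms by (intro scale_closed add_closed mult_closed L_closed)
  moreover have "Gam L u v = (\<lambda>x. (1/2) * (L (\<lambda>y. u y * v y) x + ((-1) * (u x * L v x) + (-1) * (v x * L u x))))"
    by (simp add: Gam_def fun_eq_iff field_simps)
  ultimately show ?thesis by simp
qed

lemma L_mult: "L (\<lambda>y. u y * v y) = (\<lambda>x. (u x * L v x + v x * L u x) + 2 * Gam L u v x)"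
  by (simp add: Gam_def fun_eq_iff field_simps)

lemma Gam_add:
  assumes "u \<in> A" "v \<in> A" "w \<in> A"
  shows "Gam L (\<lambda>y. u y + v y) w = (\<lambda>x. Gam L u w x + Gam L v w x)"
proof -
  have "(\<lambda>y. (u y + v y) * w y) = (\<lambda>y. u y * w y + v y * w y)"
    by (simp add: algebra_simps)
  then have "L (\<lambda>y. (u y + v y) * w y) = (\<lambda>x. L (\<lambda>y. u y * w y) x + L (\<lambda>y. v y * w y) x)"
    using assms by (simp add: L_add mult_closed)
  then show ?thesis
    using assms by (simp add: Gam_def L_add fun_eq_iff field_simps)
qed

lemma Gam_scale:
  assumes "u \<in> A" "w \<in> A"
  shows "Gam L (\<lambda>y. c * u y) w = (\<lambda>x. c * Gam L u w x)"
proof -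
  have "L (\<lambda>y. c * u y * w y) = (\<lambda>x. c * L (\<lambda>y. u y * w y) x)"
    using L_scale[OF mult_closed[OF assms], of c] by (simp add: mult.assoc)
  then show ?thesis
    using assms by (simp add: Gam_def L_scale fun_eq_iff field_simps)
qed

lemma Gam_add_right:
  assumes "u \<in> A" "v \<in> A" "w \<in> A"
  shows "Gam L w (\<lambda>y. u y + v y) = (\<lambda>x. Gam L w u x + Gam L w v x)"
  using Gam_add[OF assms] by (simp add: Gam_sym[of w])

lemma Gam_scale_right:
  assumes "u \<in> A" "w \<in> A"
  shows "Gam L w (\<lambda>y. c * u y) = (\<lambda>x. c * Gam L w u x)"
  using Gam_scale[OF assms] by (simp add: Gam_sym[of w])

text \<open>Expanding both \<open>L (u v w)\<close> and \<open>L (u v)\<close>, all terms without \<open>\<Gamma>\<close> cancel, as does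
  \<open>w \<Gamma>(u, v)\<close>.\<close>

lemma Gam_mult:
  assumes "u \<in> A" "v \<in> A" "w \<in> A"
  shows "Gam L (\<lambda>y. u y * v y) w = (\<lambda>x. u x * Gam L v w x + v x * Gam L u w x)"
proof
  fix x
  have "Gam L (\<lambda>y. u y * v y) w x =
      (L (\<lambda>y. u y * v y * w y) x - u x * v x * L w x - w x * L (\<lambda>y. u y * v y) x) / 2"
    by (simp add: Gam_def)
  also have "\<dots> = u x * Gam L v w x + v x * Gam L u w x"
    unfolding L_triple_product[OF assms] L_mult[of u v] by (simp add: field_simps)
  finally show "Gam L (\<lambda>y. u y * v y) w x = u x * Gam L v w x + v x * Gam L u w x" .
qed

lemma Gam_mult_right:
  assumes "u \<in> A" "v \<in> A" "w \<in> A"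
  shows "Gam L w (\<lambda>y. u y * v y) = (\<lambda>x. u x * Gam L w v x + v x * Gam L w u x)"
  using Gam_mult[OF assms] by (simp add: Gam_sym[of w])

section \<open>The iterated carre du champ of sums and products\<close>

lemma Gam2_sym: "Gam2 L u v = Gam2 L v u"
  by (simp add: Gam2_def Gam_sym[of u v] algebra_simps)

lemma Gam2_add_right:
  assumes "u \<in> A" "v \<in> A" "w \<in> A"
  shows "Gam2 L w (\<lambda>y. u y + v y) x = Gam2 L w u x + Gam2 L w v x"
  using assms
  by (simp add: Gam2_def Gam_add Gam_add_right L_add Gam_closed L_closed field_simps)

lemma Gam2_scale_right:
  assumes "u \<in> A" "w \<in> A"
  shows "Gam2 L w (\<lambda>y. c * u y) x = c * Gam2 L w u x"
  using assms
  by (simp add: Gam2_def Gam_scale Gam_scale_right L_scale Gam_closed L_closed field_simps)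

text \<open>Each of the three terms of \<open>\<Gamma>\<^sub>2(f, g h)\<close> is expanded by the rules for \<open>L\<close> and \<open>\<Gamma>\<close> of a
  product. The products of \<open>\<Gamma>\<close> with \<open>L g\<close> or \<open>L h\<close> cancel, and the nested terms
  \<open>\<Gamma>(g, \<Gamma>(f, h)) + \<Gamma>(h, \<Gamma>(f, g)) - \<Gamma>(f, \<Gamma>(g, h))\<close> that remain are
  twice the Hessian.\<close>

lemma Gam2_mult_right:
  assumes "f \<in> A" "g \<in> A" "h \<in> A"
  shows "Gam2 L f (\<lambda>y. g y * h y) x =
    g x * Gam2 L f h x + h x * Gam2 L f g x + 2 * Hess L f g h x"
proof -
  note closed = assms Gam_closed L_closed mult_closed add_closed scale_closed
  have 1: "L (Gam L f (\<lambda>y. g y * h y)) x =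
      (g x * L (Gam L f h) x + Gam L f h x * L g x + 2 * Gam L g (Gam L f h) x)
    + (h x * L (Gam L f g) x + Gam L f g x * L h x + 2 * Gam L h (Gam L f g) x)"
    by (simp add: Gam_mult_right L_add L_mult closed)
  have 2: "Gam L f (L (\<lambda>y. g y * h y)) x =
      (g x * Gam L f (L h) x + L h x * Gam L f g x)
    + (h x * Gam L f (L g) x + L g x * Gam L f h x)
    + 2 * Gam L f (Gam L g h) x"
    by (simp add: Gam_mult_right Gam_add_right Gam_scale_right L_mult closed)
  have 3: "Gam L (\<lambda>y. g y * h y) (L f) x = g x * Gam L h (L f) x + h x * Gam L g (L f) x"
    by (simp add: Gam_mult closed)
  show ?thesis
    by (simp add: Gam2_def[of L f "\<lambda>y. g y * h y"] 1 2 3)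
       (simp add: Gam2_def Hess_def field_simps)
qed

section \<open>Perturbation by a product vanishing to second order\<close>

text \<open>This is \<open>(g - g x) (h - h x)\<close> without its constant term \<open>g x * h x\<close>, since \<open>A\<close> need not
  contain the constants. It is written with sums and multiples only, the form in which \<open>A\<close> is
  closed and \<open>L\<close> is linear.\<close>

definition centred_product :: "'x \<Rightarrow> ('x \<Rightarrow> real) \<Rightarrow> ('x \<Rightarrow> real) \<Rightarrow> 'x \<Rightarrow> real" where
  "centred_product x g h = (\<lambda>y. g y * h y + ((- g x) * h y + (- h x) * g y))"

lemma centred_product_closed:
  "g \<in> A \<Longrightarrow> h \<in> A \<Longrightarrow> centred_product x g h \<in> A"
  unfolding centred_product_def by (intro add_closed mult_closed scale_closed)

lemma Gam_centred_product:
  assumes "g \<in> A" "h \<in> A" "w \<in> A"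
  shows "Gam L (centred_product x g h) w =
    (\<lambda>y. (g y * Gam L h w y + (- g x) * Gam L h w y)
       + (h y * Gam L g w y + (- h x) * Gam L g w y))"
  using assms unfolding centred_product_def
  by (simp only: Gam_add Gam_scale Gam_mult add_closed mult_closed scale_closed)
     (simp add: algebra_simps)

lemma Gam_centred_product_at:
  assumes "g \<in> A" "h \<in> A" "w \<in> A"
  shows "Gam L (centred_product x g h) w x = 0"
  by (simp add: Gam_centred_product assms)

lemma L_centred_product_at:
  assumes "g \<in> A" "h \<in> A"
  shows "L (centred_product x g h) x = 2 * Gam L g h x"
  using assms unfolding centred_product_def
  by (simp only: L_add L_scale add_closed mult_closed scale_closed L_mult[of g h])

lemma Gam2_centred_product_at:
  assumes "f \<in> A" "g \<in> A" "h \<in> A"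
  shows "Gam2 L f (centred_product x g h) x = 2 * Hess L f g h x"
  using assms unfolding centred_product_def
  by (simp only: Gam2_add_right Gam2_scale_right add_closed mult_closed scale_closed Gam2_mult_right)

text \<open>The function \<open>\<Gamma>(k, w) = (g - g x) \<Gamma>(h, w) + (h - h x) \<Gamma>(g, w)\<close>, for the centred
  product \<open>k\<close>, has coefficients that vanish at \<open>x\<close>, so a further derivation has to hit these
  coefficients.\<close>

lemma Gam_Gam_centred_product_at:
  assumes "g \<in> A" "h \<in> A" "u \<in> A" "w \<in> A"
  shows "Gam L u (Gam L (centred_product x g h) w) x =
    Gam L u g x * Gam L h w x + Gam L u h x * Gam L g w x"
  using assms
  by (simp only: Gam_centred_product Gam_add_right Gam_mult_right Gam_scale_right
      add_closed mult_closed scale_closed Gam_closed)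
     (simp add: algebra_simps)

text \<open>For the centred product \<open>k\<close>, the value \<open>\<Gamma>\<^sub>2(k, k)\<close> at \<open>x\<close> is twice the Hessian
  \<open>H\<^sub>k(g, h)\<close>. Its last term \<open>\<Gamma>(k, \<Gamma>(g, h))\<close> vanishes at \<open>x\<close>, and its first two are equal
  there.\<close>

lemma Gam2_centred_product_self_at:
  assumes "g \<in> A" "h \<in> A"
  shows "Gam2 L (centred_product x g h) (centred_product x g h) x =
    2 * (Gam L g g x * Gam L h h x + (Gam L g h x)\<^sup>2)"
  using assms
  by (simp add: Gam2_centred_product_at centred_product_closed Hess_def
      Gam_Gam_centred_product_at Gam_centred_product_at Gam_closed Gam_sym[of h g] power2_eq_square)

text \<open>The competitor \<open>f + t k\<close> in the infimum, with \<open>k\<close> the centred product: the value of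
  \<open>\<Gamma>\<^sub>2(f + t k) - (L (f + t k))\<^sup>2 / N\<close> at \<open>x\<close> is a quadratic polynomial in \<open>t\<close>.\<close>

lemma Ricci_le_perturbed:
  fixes t :: real
  assumes f: "f \<in> A" and g: "g \<in> A" and h: "h \<in> A"
  shows "Ricci A L N f x \<le> ereal (
      Gam2 L f f x + 4 * t * Hess L f g h x
      + 2 * t\<^sup>2 * (Gam L g g x * Gam L h h x + (Gam L g h x)\<^sup>2)
      - inv_dim N * (L f x + 2 * t * Gam L g h x)\<^sup>2)"
proof -
  let ?k = "centred_product x g h"
  let ?F = "\<lambda>y. f y + t * ?k y"
  have k: "?k \<in> A" using g h by (rule centred_product_closed)
  have F: "?F \<in> A" using f k by (intro add_closed scale_closed)
  have "Gam L (\<lambda>y. ?F y - f y) (\<lambda>y. ?F y - f y) x = 0"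
    using g h k by (simp add: Gam_scale Gam_scale_right scale_closed Gam_centred_product_at)
  with F have mem: "?F \<in> {f' \<in> A. Gam L (\<lambda>y. f' y - f y) (\<lambda>y. f' y - f y) x = 0}" by blast
  have LF: "L ?F x = L f x + 2 * t * Gam L g h x"
    using f g h k by (simp add: L_add L_scale scale_closed L_centred_product_at)
  have right: "Gam2 L w ?F x = Gam2 L w f x + t * Gam2 L w ?k x" if "w \<in> A" for w
    using that f k by (simp add: Gam2_add_right Gam2_scale_right scale_closed)
  have "Gam2 L ?F ?F x = (Gam2 L f f x + t * Gam2 L f ?k x) + t * (Gam2 L f ?k x + t * Gam2 L ?k ?k x)"
    using right[OF F] right[OF f] right[OF k]
    by (simp add: Gam2_sym[of ?F f] Gam2_sym[of ?F ?k] Gam2_sym[of ?k f])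
  then have "Gam2 L ?F ?F x = Gam2 L f f x + 4 * t * Hess L f g h x
      + 2 * t\<^sup>2 * (Gam L g g x * Gam L h h x + (Gam L g h x)\<^sup>2)"
    unfolding Gam2_centred_product_at[OF f g h] Gam2_centred_product_self_at[OF g h]
    by (simp add: algebra_simps power2_eq_square)
  with LF have eq: "Gam2 L ?F ?F x - inv_dim N * (L ?F x)\<^sup>2 =
      Gam2 L f f x + 4 * t * Hess L f g h x
      + 2 * t\<^sup>2 * (Gam L g g x * Gam L h h x + (Gam L g h x)\<^sup>2)
      - inv_dim N * (L f x + 2 * t * Gam L g h x)\<^sup>2" by simp
  show ?thesis
    unfolding Ricci_def eq[symmetric] using mem by (rule INF_lower)
qed

end

section \<open>Optimising the perturbation\<close>

text \<open>For \<open>c \<noteq> 0\<close> the bound comes from the critical point \<open>t = - b / c\<close> of the quadratic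
  polynomial, where its value is \<open>a - 2 b\<^sup>2 / c\<close>. For \<open>c = 0\<close> the infimum over \<open>t\<close> is \<open>a\<close> if
  \<open>b = 0\<close> and \<open>-\<infinity>\<close> otherwise, in accordance with the values \<open>0\<close> and \<open>\<infinity>\<close> of \<open>ext_quot\<close>.\<close>

lemma le_of_le_quadratic:
  fixes R :: ereal and a b c :: real
  assumes "\<And>t. R \<le> ereal (a + 4 * t * b + 2 * t\<^sup>2 * c)"
  shows "R \<le> ereal a - 2 * ext_quot (b\<^sup>2) c"
proof (cases "c = 0")
  case False
  have eq: "a + 4 * (- b / c) * b + 2 * (- b / c)\<^sup>2 * c = a - 2 * (b\<^sup>2 / c)"
    using False by (simp add: field_simps power2_eq_square)
  then show ?thesis
    using assms[of "- b / c"] False unfolding eq by (simp add: ext_quot_def)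
next
  case c: True
  show ?thesis
  proof (cases "b = 0")
    case True
    then show ?thesis using assms[of 0] c by (simp add: ext_quot_def)
  next
    case False
    \<comment> \<open>The affine bound \<open>a + 4 t b\<close> takes the value \<open>B\<close> at \<open>t = (B - a) / (4 b)\<close>.\<close>
    have "R \<le> ereal B" for B
    proof -
      have "a + 4 * ((B - a) / (4 * b)) * b + 2 * ((B - a) / (4 * b))\<^sup>2 * c = B"
        using c False by (simp add: field_simps)
      then show ?thesis using assms[of "(B - a) / (4 * b)"] by (simp only:)
    qed
    then have "R = -\<infinity>"
      by (rule ereal_bot)
    then show ?thesis by simp
  qed
qed

lemma dim_ratio_eq: "1 \<le> N \<Longrightarrow> dim_ratio N = 1 - 2 * inv_dim N"
  by (cases N) (auto simp: dim_ratio_def inv_dim_def field_simps one_ereal_def)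

theorem theorem3p1:
  fixes A :: "('x \<Rightarrow> real) set"
    and L :: "('x \<Rightarrow> real) \<Rightarrow> ('x \<Rightarrow> real)"
    and N :: ereal
    and f g h :: "'x \<Rightarrow> real"
    and x :: 'x
  assumes "diffusion_operator A L"
    and "1 \<le> N"
    and "f \<in> A" and "g \<in> A" and "h \<in> A"
  shows "Ricci A L N f x \<le>
    ereal (Gam2 L f f x) -
      (ereal (inv_dim N * (L f x)\<^sup>2) +
       2 * ext_quot ((Hess L f g h x - inv_dim N * Gam L g h x * L f x)\<^sup>2)
             (dim_ratio N * (Gam L g h x)\<^sup>2 + Gam L g g x * Gam L h h x))"
proof -
  let ?a = "Gam2 L f f x - inv_dim N * (L f x)\<^sup>2"
  let ?b = "Hess L f g h x - inv_dim N * Gam L g h x * L f x"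
  let ?c = "dim_ratio N * (Gam L g h x)\<^sup>2 + Gam L g g x * Gam L h h x"
  have "Ricci A L N f x \<le> ereal (?a + 4 * t * ?b + 2 * t\<^sup>2 * ?c)" for t
  proof -
    have eq: "Gam2 L f f x + 4 * t * Hess L f g h x
        + 2 * t\<^sup>2 * (Gam L g g x * Gam L h h x + (Gam L g h x)\<^sup>2)
        - inv_dim N * (L f x + 2 * t * Gam L g h x)\<^sup>2 = ?a + 4 * t * ?b + 2 * t\<^sup>2 * ?c"
      unfolding dim_ratio_eq[OF \<open>1 \<le> N\<close>] by (simp add: algebra_simps power2_eq_square)
    show ?thesis
      using diffusion_operator.Ricci_le_perturbed[OF assms(1,3-5), of N x t] by (simp only: eq)
  qed
  then have "Ricci A L N f x \<le> ereal ?a - 2 * ext_quot (?b\<^sup>2) ?c"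
    by (rule le_of_le_quadratic)
  also have "\<dots> = ereal (Gam2 L f f x) -
      (ereal (inv_dim N * (L f x)\<^sup>2) + 2 * ext_quot (?b\<^sup>2) ?c)"
    by (cases "ext_quot (?b\<^sup>2) ?c") (auto simp: ext_quot_def split: if_splits)
  finally show ?thesis .
qed

end
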